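(* Let $f$ be a function on $\mathbb{R}^n$ and let $f^*$ be its Fenchel conjugate. Let $\mu>0$ and $L>0$. (i) If $f$ is closed and strongly convex with parameter $\mu$, then $f^*$ has a Lipschitz continuous gradient with parameter $\frac{1}{\mu}$. (ii) If $f$ is convex and has a Lipschitz continuous gradient with parameter $L$, then $f^*$ is strongly convex with parameter $\frac{1}{L}$.
   Context: Functions on $\mathbb{R}^n$ are extended-valued: $f:\mathbb{R}^n\to\mathbb{R}\cup\{+\infty\}$, real-valued on its nonempty domain and equal to $+\infty$ outside it. $\|\cdot\|$ is the Euclidean norm. The function $f$ is closed if its epigraph is closed. The Fenchel conjugate of $f$ is $f^*(s)=\sup_{x\in\mathbb{R}^n}(s^Tx-f(x))$. A function $h:\mathbb{R}^n\to\mathbb{R}\cup\{+\infty\}$ is strongly convex with parameter $m>0$ if $x\mapsto h(x)-\frac{m}{2}x^Tx$ is convex. A function $h$ has a Lipschitz continuous gradient with parameter $K$ if $h$ is real-valued and differentiable on $\mathbb{R}^n$ and $\|\nabla h(x)-\nabla h(y)\|\le K\|x-y\|$ for all $x,y\in\mathbb{R}^n$. *)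

theory Defs
  imports "HOL-Analysis.Analysis"
begin

text \<open>
  A function \<open>f\<close> into \<open>\<real> \<union> {+\<infinity>}\<close> with nonempty domain is a function into \<^typ>\<open>ereal\<close>
  that satisfies the following predicate.
\<close>

definition proper_fun :: "('a \<Rightarrow> ereal) \<Rightarrow> bool" where
  "proper_fun f \<longleftrightarrow> (\<forall>x. f x \<noteq> -\<infinity>) \<and> (\<exists>x. f x \<noteq> \<infinity>)"

definition epi :: "('a \<Rightarrow> ereal) \<Rightarrow> ('a \<times> real) set" where
  "epi f = {(x, t). f x \<le> ereal t}"

definition closed_fun :: "('a::topological_space \<Rightarrow> ereal) \<Rightarrow> bool" where
  "closed_fun f \<longleftrightarrow> closed (epi f)"

text \<open>
  The following is meaningful for functions that never take the value \<open>-\<infinity>\<close>, since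
  \<open>\<infinity> + (-\<infinity>) = \<infinity>\<close> in \<^typ>\<open>ereal\<close>; it is only used for such functions.
\<close>

definition convex_fun :: "('a::real_vector \<Rightarrow> ereal) \<Rightarrow> bool" where
  "convex_fun f \<longleftrightarrow> (\<forall>x y t. 0 < t \<and> t < 1 \<longrightarrow>
     f ((1 - t) *\<^sub>R x + t *\<^sub>R y) \<le> ereal (1 - t) * f x + ereal t * f y)"

definition strongly_convex_fun :: "real \<Rightarrow> ('a::real_inner \<Rightarrow> ereal) \<Rightarrow> bool" where
  "strongly_convex_fun m h \<longleftrightarrow> proper_fun h \<and> convex_fun (\<lambda>x. h x - ereal (m / 2 * (x \<bullet> x)))"

definition lipschitz_gradient :: "real \<Rightarrow> ('a::real_inner \<Rightarrow> ereal) \<Rightarrow> bool" where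
  "lipschitz_gradient K h \<longleftrightarrow> (\<forall>x. \<bar>h x\<bar> \<noteq> \<infinity>) \<and>
     (\<exists>G. (\<forall>x. GDERIV (\<lambda>z. real_of_ereal (h z)) x :> G x) \<and>
          (\<forall>x y. norm (G x - G y) \<le> K * norm (x - y)))"

definition fenchel_conjugate :: "('a::real_inner \<Rightarrow> ereal) \<Rightarrow> 'a \<Rightarrow> ereal" where
  "fenchel_conjugate f s = (SUP x. ereal (s \<bullet> x) - f x)"

text \<open>Relation to the library notions for real-valued functions on a set.\<close>

lemma epi_eq_epigraph:
  assumes "\<And>x. f x \<noteq> -\<infinity>"
  shows "epi f = epigraph {x. f x \<noteq> \<infinity>} (\<lambda>x. real_of_ereal (f x))"
proof -
  have "f x \<le> ereal t \<longleftrightarrow> f x \<noteq> \<infinity> \<and> real_of_ereal (f x) \<le> t" for x t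
    using assms[of x] by (cases "f x") auto
  then show ?thesis
    by (auto simp: epi_def epigraph_def)
qed

lemma convex_fun_iff_convex_on:
  fixes f :: "'a::real_vector \<Rightarrow> ereal"
  assumes "\<And>x. f x \<noteq> -\<infinity>"
  shows "convex_fun f \<longleftrightarrow> convex_on {x. f x \<noteq> \<infinity>} (\<lambda>x. real_of_ereal (f x))"
proof -
  let ?D = "{x. f x \<noteq> \<infinity>}" and ?g = "\<lambda>x. real_of_ereal (f x)"
  have fin: "f x = ereal (?g x)" if "x \<in> ?D" for x
    using assms[of x] that by (cases "f x") auto
  show ?thesis
  proof
    assume c: "convex_fun f"
    have J: "(1 - t) *\<^sub>R x + t *\<^sub>R y \<in> ?D \<and>
        ?g ((1 - t) *\<^sub>R x + t *\<^sub>R y) \<le> (1 - t) * ?g x + t * ?g y"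
      if "0 < t" "t < 1" "x \<in> ?D" "y \<in> ?D" for t :: real and x y :: 'a
    proof -
      let ?z = "(1 - t) *\<^sub>R x + t *\<^sub>R y"
      have "f ?z \<le> ereal (1 - t) * f x + ereal t * f y"
        using c that unfolding convex_fun_def by blast
      also have "\<dots> = ereal ((1 - t) * ?g x + t * ?g y)"
        by (subst fin[OF that(3)], subst fin[OF that(4)]) simp
      finally show ?thesis
        using assms[of ?z] by (cases "f ?z") auto
    qed
    show "convex_on ?D ?g"
    proof (rule convex_onI)
      show "convex ?D"
        unfolding convex_alt
      proof (intro ballI allI impI)
        fix x y :: 'a and u :: real
        assume "x \<in> ?D" "y \<in> ?D" "0 \<le> u \<and> u \<le> 1"
        then show "(1 - u) *\<^sub>R x + u *\<^sub>R y \<in> ?D"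
          using J[of u x y] by (cases "u = 0"; cases "u = 1") auto
      qed
    qed (use J in blast)
  next
    assume c: "convex_on ?D ?g"
    show "convex_fun f"
      unfolding convex_fun_def
    proof (intro allI impI)
      fix x y :: 'a and t :: real
      assume t: "0 < t \<and> t < 1"
      let ?z = "(1 - t) *\<^sub>R x + t *\<^sub>R y"
      show "f ?z \<le> ereal (1 - t) * f x + ereal t * f y"
      proof (cases "x \<in> ?D \<and> y \<in> ?D")
        case True
        then have x: "x \<in> ?D" and y: "y \<in> ?D" by auto
        have "convex ?D" using c by (rule convex_on_imp_convex)
        then have z: "?z \<in> ?D" using x y t unfolding convex_alt by auto
        have "?g ?z \<le> (1 - t) * ?g x + t * ?g y"
          using convex_onD[OF c, of t x y] x y t by auto
        then show ?thesis
          by (subst fin[OF x], subst fin[OF y], subst fin[OF z]) simp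
      next
        case False
        then have "ereal (1 - t) * f x + ereal t * f y = \<infinity>"
          using t assms[of x] assms[of y] by (cases "f x"; cases "f y") auto
        then show ?thesis by (simp only: ereal_less_eq)
      qed
    qed
  qed
qed

end

theory Submission
  imports Defs
begin

text \<open>
  Strong convexity is used in the form of the strengthened Jensen inequality
  \[ h((1-t)x + ty) \le (1-t)h(x) + t\,h(y) - \frac{m}{2}\,t(1-t)\|x-y\|^2 . \]

  \<^emph>\<open>Part (i).\<close> The tilted function \<open>y \<mapsto> f y - s \<bullet> y\<close> is again closed and strongly convex. It
  grows quadratically, so by compactness it has a minimizer \<open>X s\<close>, and it exceeds its minimum by at
  least \<open>\<mu>/2 \<cdot> \<parallel>y - X s\<parallel>\<^sup>2\<close>. Thus the supremum that defines \<open>f\<^sup>*(s)\<close> is attained at \<open>X s\<close>, which makes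
  \<open>X s\<close> a subgradient of \<open>f\<^sup>*\<close> at \<open>s\<close>; and adding the quadratic growth estimates for \<open>s\<close> and \<open>u\<close>, each
  evaluated at the other minimizer, yields
  \<open>\<mu> \<parallel>X s - X u\<parallel>\<^sup>2 \<le> (s - u) \<bullet> (X s - X u)\<close>. So \<open>X\<close> is Lipschitz with constant
  \<open>1/\<mu>\<close>, and a Lipschitz selection of subgradients is a gradient
  (\<open>subgradient_selection_imp_gderiv\<close>).

  \<^emph>\<open>Part (ii).\<close> A Lipschitz gradient bounds \<open>f\<close> from above by a quadratic around every point \<open>z\<close>
  (\<open>descent_lemma\<close>). Let \<open>w = (1-t)s + tu\<close>. Testing \<open>f\<^sup>*(s)\<close> at \<open>z - tv\<close> and \<open>f\<^sup>*(u)\<close> at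
  \<open>z + (1-t)v\<close>, the gradient terms cancel in the convex combination, and
  \<open>(1-t)f\<^sup>*(s) + t f\<^sup>*(u)\<close> is at least \<open>w \<bullet> z - f z + t(1-t)((u-s) \<bullet> v - L/2 \<cdot> \<parallel>v\<parallel>\<^sup>2)\<close>. The best choice
  \<open>v = (u-s)/L\<close> gives the required gain, uniformly in \<open>z\<close>; now take the supremum over \<open>z\<close>. That \<open>f\<^sup>*\<close>
  is proper follows from the tangent inequality for \<open>f\<close>, which makes \<open>f\<^sup>*\<close> finite at
  every gradient of \<open>f\<close>.
\<close>

section \<open>Strong convexity as a strengthened Jensen inequality\<close>

text \<open>
  The quadratic gap comes from
  \<open>(1-t)\<parallel>x\<parallel>\<^sup>2 + t\<parallel>y\<parallel>\<^sup>2 - \<parallel>(1-t)x + ty\<parallel>\<^sup>2 = t(1-t)\<parallel>x-y\<parallel>\<^sup>2\<close>. Only points of the domain need to be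
  tested, because otherwise the upper bound in the convexity inequality is \<open>\<infinity>\<close>.
\<close>

lemma strongly_convex_fun_iff:
  fixes h :: "'a::real_inner \<Rightarrow> ereal"
  shows "strongly_convex_fun m h \<longleftrightarrow> proper_fun h \<and>
    (\<forall>x y a b t. 0 < t \<and> t < 1 \<and> h x = ereal a \<and> h y = ereal b \<longrightarrow>
      h ((1 - t) *\<^sub>R x + t *\<^sub>R y) \<le> ereal ((1 - t) * a + t * b - m / 2 * (t * (1 - t)) * (norm (x - y))\<^sup>2))"
    (is "_ \<longleftrightarrow> _ \<and> ?J")
proof -
  let ?g = "\<lambda>x. h x - ereal (m / 2 * (x \<bullet> x))"
  have gap: "m / 2 * (z \<bullet> z) = (1 - t) * (m / 2 * (x \<bullet> x)) + t * (m / 2 * (y \<bullet> y))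
      - m / 2 * (t * (1 - t)) * (norm (x - y))\<^sup>2"
    if "z = (1 - t) *\<^sub>R x + t *\<^sub>R y" for x y z :: 'a and t
    unfolding that power2_norm_eq_inner
    by (simp add: inner_add inner_diff inner_commute field_simps)
  have "convex_fun ?g \<longleftrightarrow> ?J" if p: "proper_fun h"
  proof -
    have step: "?g z \<le> ereal (1 - t) * ?g x + ereal t * ?g y \<longleftrightarrow>
        h z \<le> ereal ((1 - t) * a + t * b - m / 2 * (t * (1 - t)) * (norm (x - y))\<^sup>2)"
      if "z = (1 - t) *\<^sub>R x + t *\<^sub>R y" "h x = ereal a" "h y = ereal b" for x y z a b t
      using gap[OF that(1)] that(2,3) by (cases "h z") (auto simp: algebra_simps)
    have top: "ereal (1 - t) * ?g x + ereal t * ?g y = \<infinity>"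
      if "0 < t" "t < 1" "h x = \<infinity> \<or> h y = \<infinity>" for x y t
      using that p unfolding proper_fun_def by (cases "h x"; cases "h y") auto
    have fin: "h x = \<infinity> \<or> (\<exists>a. h x = ereal a)" for x
      using p unfolding proper_fun_def by (cases "h x") auto
    show ?thesis
    proof
      assume conv: "convex_fun ?g"
      show ?J
      proof (intro allI impI)
        fix x y :: 'a and a b t :: real
        assume A: "0 < t \<and> t < 1 \<and> h x = ereal a \<and> h y = ereal b"
        let ?z = "(1 - t) *\<^sub>R x + t *\<^sub>R y"
        have "?g ?z \<le> ereal (1 - t) * ?g x + ereal t * ?g y"
          using conv[unfolded convex_fun_def, rule_format, of t x y] A by blast
        then show "h ?z \<le> ereal ((1 - t) * a + t * b - m / 2 * (t * (1 - t)) * (norm (x - y))\<^sup>2)"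
          using step[OF refl] A by simp
      qed
    next
      assume J: ?J
      show "convex_fun ?g"
        unfolding convex_fun_def
      proof (intro allI impI)
        fix x y :: 'a and t :: real
        assume t: "0 < t \<and> t < 1"
        let ?z = "(1 - t) *\<^sub>R x + t *\<^sub>R y"
        show "?g ?z \<le> ereal (1 - t) * ?g x + ereal t * ?g y"
        proof (cases "h x = \<infinity> \<or> h y = \<infinity>")
          case True
          then have "ereal (1 - t) * ?g x + ereal t * ?g y = \<infinity>"
            using top t by blast
          then show ?thesis by (simp only: ereal_less_eq)
        next
          case False
          then obtain a b where ab: "h x = ereal a" "h y = ereal b"
            using fin by blast
          then have "h ?z \<le> ereal ((1 - t) * a + t * b - m / 2 * (t * (1 - t)) * (norm (x - y))\<^sup>2)"
            using J t by blast
          then show ?thesis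
            using step[OF refl ab] by simp
        qed
      qed
    qed
  qed
  then show ?thesis
    unfolding strongly_convex_fun_def by blast
qed

lemma strongly_convex_fun_tilt:
  fixes h :: "'a::real_inner \<Rightarrow> ereal"
  assumes "strongly_convex_fun m h"
  shows "strongly_convex_fun m (\<lambda>x. h x - ereal (s \<bullet> x))"
  unfolding strongly_convex_fun_iff
proof (intro conjI allI impI)
  have p: "proper_fun h"
    using assms strongly_convex_fun_iff by blast
  then obtain x0 where "h x0 \<noteq> \<infinity>" and ninf: "\<And>x. h x \<noteq> -\<infinity>"
    unfolding proper_fun_def by blast
  then have "h x0 - ereal (s \<bullet> x0) \<noteq> \<infinity>"
    by (cases "h x0") auto
  moreover have "h x - ereal (s \<bullet> x) \<noteq> -\<infinity>" for x
    using ninf[of x] by (cases "h x") auto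
  ultimately show "proper_fun (\<lambda>x. h x - ereal (s \<bullet> x))"
    unfolding proper_fun_def by blast
  fix x y :: 'a and a b t :: real
  assume A: "0 < t \<and> t < 1 \<and> h x - ereal (s \<bullet> x) = ereal a \<and> h y - ereal (s \<bullet> y) = ereal b"
  let ?z = "(1 - t) *\<^sub>R x + t *\<^sub>R y"
  have "h x = ereal (a + s \<bullet> x)" "h y = ereal (b + s \<bullet> y)"
    using A by (cases "h x"; cases "h y"; auto)+
  then have "h ?z \<le> ereal ((1 - t) * (a + s \<bullet> x) + t * (b + s \<bullet> y)
      - m / 2 * (t * (1 - t)) * (norm (x - y))\<^sup>2)"
    using A assms unfolding strongly_convex_fun_iff by blast
  then show "h ?z - ereal (s \<bullet> ?z)
      \<le> ereal ((1 - t) * a + t * b - m / 2 * (t * (1 - t)) * (norm (x - y))\<^sup>2)"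
    by (cases "h ?z") (auto simp: inner_add algebra_simps)
qed

lemma closed_fun_tilt:
  fixes h :: "'a::real_inner \<Rightarrow> ereal"
  assumes "closed_fun h"
  shows "closed_fun (\<lambda>x. h x - ereal (s \<bullet> x))"
proof -
  have "h x - ereal (s \<bullet> x) \<le> ereal t \<longleftrightarrow> h x \<le> ereal (t + s \<bullet> x)" for x t
    by (cases "h x") auto
  then have "epi (\<lambda>x. h x - ereal (s \<bullet> x)) = (\<lambda>p. (fst p, snd p + s \<bullet> fst p)) -` epi h"
    by (auto simp: epi_def)
  moreover have "closed ((\<lambda>p. (fst p, snd p + s \<bullet> fst p)) -` epi h)"
    using assms unfolding closed_fun_def
    by (intro closed_vimage) (auto intro!: continuous_intros)
  ultimately show ?thesis
    unfolding closed_fun_def by simp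
qed

section \<open>Minimizers of closed strongly convex functions\<close>

lemma closed_sublevel:
  fixes f :: "'a::topological_space \<Rightarrow> ereal"
  assumes "closed_fun f"
  shows "closed {x. f x \<le> ereal r}"
proof -
  have "{x. f x \<le> ereal r} = (\<lambda>x. (x, r)) -` epi f"
    by (auto simp: epi_def)
  then show ?thesis
    using assms unfolding closed_fun_def
    by (auto intro!: closed_vimage continuous_intros)
qed

text \<open>
  A minimizer is a common point of all sublevel sets in \<open>K\<close> above the infimum. These sets are compact
  and nested, so the finite intersection property applies.
\<close>

lemma closed_fun_attains_inf:
  fixes f :: "'a::t2_space \<Rightarrow> ereal"
  assumes "closed_fun f" "compact K" "K \<noteq> {}"
  shows "\<exists>x\<in>K. \<forall>y\<in>K. f x \<le> f y"
proof -
  let ?I = "INF y\<in>K. f y"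
  let ?S = "\<lambda>r. {x. f x \<le> ereal r}"
  have "K \<inter> \<Inter>(?S ` {r. ?I < ereal r}) \<noteq> {}"
  proof (rule compact_imp_fip[OF assms(2)])
    fix T assume "T \<in> ?S ` {r. ?I < ereal r}"
    then show "closed T"
      using closed_sublevel[OF assms(1)] by blast
  next
    fix F assume F: "finite F" "F \<subseteq> ?S ` {r. ?I < ereal r}"
    then obtain R where R: "finite R" "R \<subseteq> {r. ?I < ereal r}" "F = ?S ` R"
      by (meson finite_subset_image)
    show "K \<inter> \<Inter>F \<noteq> {}"
    proof (cases "R = {}")
      case True
      then show ?thesis using R assms(3) by auto
    next
      case False
      then have "?I < ereal (Min R)"
        using R Min_in by blast
      then obtain x where x: "x \<in> K" "f x < ereal (Min R)"
        by (auto simp: INF_less_iff)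
      have "f x \<le> ereal r" if "r \<in> R" for r
      proof -
        have "ereal (Min R) \<le> ereal r" using R(1) that by simp
        then show ?thesis using x(2) by order
      qed
      then show ?thesis using x(1) R(3) by auto
    qed
  qed
  then obtain x where x: "x \<in> K" "\<And>r. ?I < ereal r \<Longrightarrow> f x \<le> ereal r"
    by auto
  have "f x \<le> ?I"
  proof (rule ccontr)
    assume "\<not> ?thesis"
    then obtain r where "?I < ereal r" "ereal r < f x"
      using ereal_dense2[of ?I "f x"] by (auto simp: not_le)
    then show False using x(2)[of r] by simp
  qed
  then show ?thesis
    using x(1) INF_lower order_trans by metis
qed

text \<open>
  Let \<open>f x\<^sub>0\<close> be finite, and let \<open>b\<close> be the minimum on the unit ball around \<open>x\<^sub>0\<close>. For \<open>y\<close> at distance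
  \<open>d \<ge> 1\<close> from \<open>x\<^sub>0\<close>, the segment from \<open>x\<^sub>0\<close> to \<open>y\<close> leaves the ball at a point where \<open>f\<close> is at least
  \<open>b\<close>; the strengthened Jensen inequality turns this into
  \<open>f y \<ge> f x\<^sub>0 + d (b - f x\<^sub>0) + m/2 \<cdot> d (d - 1)\<close>. So outside a large ball \<open>f\<close> exceeds \<open>f x\<^sub>0\<close>, and
  the minimum over that ball is global.
\<close>

lemma closed_strongly_convex_attains_inf:
  fixes f :: "'a::euclidean_space \<Rightarrow> ereal"
  assumes "closed_fun f" "strongly_convex_fun m f" "m > 0"
  shows "\<exists>x. \<forall>y. f x \<le> f y"
proof -
  have p: "proper_fun f"
    using assms(2) strongly_convex_fun_iff by blast
  then obtain x0 a where x0: "f x0 = ereal a" and ninf: "\<And>x. f x \<noteq> -\<infinity>"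
    unfolding proper_fun_def by (metis ereal_cases)
  obtain x1 where x1: "\<And>y. y \<in> cball x0 1 \<Longrightarrow> f x1 \<le> f y"
    using closed_fun_attains_inf[OF assms(1) compact_cball[of x0 1]]
    by (metis cball_eq_empty not_one_less_zero)
  have "f x1 \<le> ereal a"
    using x1[of x0] x0 by simp
  then obtain b where b: "f x1 = ereal b" "b \<le> a"
    using ninf[of x1] by (cases "f x1") auto
  \<comment> \<open>the radius from which on the lower bound for \<open>f y\<close> is above \<open>f x\<^sub>0\<close>\<close>
  define R where "R = 1 + 2 * (a - b) / m"
  have R1: "R \<ge> 1"
    unfolding R_def using b assms(3) by simp
  have far: "f x0 \<le> f y" if far: "dist x0 y > R" for y
  proof (cases "f y")
    case (real c)
    let ?d = "dist x0 y"
    define t where "t = 1 / ?d"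
    have d: "?d > 1" using far R1 by simp
    then have t: "0 < t" "t < 1" "t * ?d = 1"
      unfolding t_def by (auto simp: divide_less_eq)
    let ?z = "(1 - t) *\<^sub>R x0 + t *\<^sub>R y"
    have "dist x0 ?z = norm (t *\<^sub>R (x0 - y))"
      unfolding dist_norm by (simp add: algebra_simps)
    then have "?z \<in> cball x0 1"
      using t by (simp add: dist_norm)
    then have "ereal b \<le> f ?z"
      using x1 b(1) by metis
    also have "f ?z \<le> ereal ((1 - t) * a + t * c - m / 2 * (t * (1 - t)) * (norm (x0 - y))\<^sup>2)"
      using assms(2) t x0 real unfolding strongly_convex_fun_iff by blast
    finally have "b \<le> (1 - t) * a + t * c - m / 2 * (t * (1 - t)) * ?d\<^sup>2"
      by (simp add: dist_norm)
    also have "m / 2 * (t * (1 - t)) * ?d\<^sup>2 = m / 2 * (?d - 1)"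
    proof -
      have "t * (1 - t) * ?d\<^sup>2 = (t * ?d) * (?d - t * ?d)"
        by (simp add: algebra_simps power2_eq_square)
      then show ?thesis using t(3) by simp
    qed
    finally have "m / 2 * (?d - 1) - (a - b) \<le> t * (c - a)"
      by (simp add: algebra_simps)
    moreover have "m / 2 * (?d - 1) > a - b"
      using far assms(3) unfolding R_def by (simp add: field_simps)
    ultimately have "0 < t * (c - a)" by linarith
    then have "a \<le> c"
      using t(1) by (simp add: zero_less_mult_iff)
    then show ?thesis using x0 real by simp
  qed (use ninf in auto)
  obtain x where x: "\<And>y. y \<in> cball x0 R \<Longrightarrow> f x \<le> f y"
    using closed_fun_attains_inf[OF assms(1) compact_cball[of x0 R]] R1
    by (metis cball_eq_empty not_less order_trans zero_le_one)
  have "f x \<le> f x0" using x[of x0] R1 by simp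
  then have "f x \<le> f y" for y
    using x[of y] far[of y] by (cases "dist x0 y \<le> R") auto
  then show ?thesis by blast
qed

text \<open>
  Comparing the minimum with the value at a point of the segment from \<open>x\<close> to \<open>y\<close> at parameter \<open>t\<close>
  leaves \<open>f y - f x \<ge> m/2 \<cdot> (1 - t) \<parallel>y - x\<parallel>\<^sup>2\<close> after division by \<open>t\<close>; now let \<open>t\<close> tend to \<open>0\<close>.
\<close>

lemma strongly_convex_minimizer_growth:
  fixes f :: "'a::real_inner \<Rightarrow> ereal"
  assumes "strongly_convex_fun m f" and min: "\<And>y. f x \<le> f y"
    and "f x = ereal a" "f y = ereal b"
  shows "a + m / 2 * (norm (y - x))\<^sup>2 \<le> b"
proof -
  let ?q = "m / 2 * (norm (x - y))\<^sup>2"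
  have "(1 - t) * ?q \<le> b - a" if t: "0 < t" "t < 1" for t
  proof -
    have "ereal a \<le> f ((1 - t) *\<^sub>R x + t *\<^sub>R y)"
      using min assms(3) by metis
    also have "\<dots> \<le> ereal ((1 - t) * a + t * b - m / 2 * (t * (1 - t)) * (norm (x - y))\<^sup>2)"
      using assms(1,3,4) t unfolding strongly_convex_fun_iff by blast
    finally have "t * ((1 - t) * ?q) \<le> t * (b - a)"
      by (simp add: algebra_simps)
    then show ?thesis using t(1) by simp
  qed
  then have "\<forall>\<^sub>F t in at_right (0::real). (1 - t) * ?q \<le> b - a"
    by (auto simp: eventually_at_right_field intro!: exI[of _ 1])
  moreover have "((\<lambda>t::real. (1 - t) * ?q) \<longlongrightarrow> (1 - 0) * ?q) (at_right 0)"
    by (intro tendsto_intros)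
  ultimately have "(1 - 0) * ?q \<le> b - a"
    by (intro tendsto_upperbound) auto
  then show ?thesis
    by (simp add: norm_minus_commute)
qed

section \<open>Differentiability of the conjugate\<close>

text \<open>
  The subgradient inequalities at \<open>s\<close> and \<open>u\<close> squeeze the error of the linear approximation between
  \<open>0\<close> and \<open>(u - s) \<bullet> (X u - X s) \<le> C \<parallel>u - s\<parallel>\<^sup>2\<close>.
\<close>

lemma subgradient_selection_imp_gderiv:
  fixes g :: "'a::real_inner \<Rightarrow> real"
  assumes sub: "\<And>s u. g s + (u - s) \<bullet> X s \<le> g u"
    and lip: "\<And>s u. norm (X s - X u) \<le> C * norm (s - u)"
  shows "GDERIV g s :> X s"
  unfolding gderiv_def has_derivative_at_within
proof (intro conjI)
  show "bounded_linear (\<lambda>h. h \<bullet> X s)"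
    by (rule bounded_linear_inner_left)
  have bound: "norm ((g u - g s - (u - s) \<bullet> X s) /\<^sub>R norm (u - s)) \<le> C * norm (u - s)" for u
  proof (cases "u = s")
    case False
    have "\<bar>g u - g s - (u - s) \<bullet> X s\<bar> \<le> (u - s) \<bullet> (X u - X s)"
      using sub[of s u] sub[of u s] by (simp add: inner_diff algebra_simps)
    also have "\<dots> \<le> norm (u - s) * norm (X u - X s)"
      by (rule norm_cauchy_schwarz)
    also have "\<dots> \<le> norm (u - s) * (C * norm (u - s))"
      by (intro mult_left_mono lip) simp
    finally show ?thesis
      using False by (simp add: field_simps)
  qed simp
  have "((\<lambda>u. C * norm (u - s)) \<longlongrightarrow> C * norm (s - s)) (at s)"
    by (intro tendsto_intros)
  then have "((\<lambda>u. C * norm (u - s)) \<longlongrightarrow> 0) (at s)"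
    by simp
  then show "((\<lambda>u. (g u - g s - (u - s) \<bullet> X s) /\<^sub>R norm (u - s)) \<longlongrightarrow> 0) (at s)"
    by (rule Lim_null_comparison[OF always_eventually[OF allI[OF bound]]])
qed

theorem conjugate_lipschitz_gradient:
  fixes f :: "'a::euclidean_space \<Rightarrow> ereal"
  assumes cl: "closed_fun f" and sc: "strongly_convex_fun \<mu> f" and pos: "\<mu> > 0"
  shows "lipschitz_gradient (1 / \<mu>) (fenchel_conjugate f)"
proof -
  have "\<exists>x. \<forall>y. f x - ereal (s \<bullet> x) \<le> f y - ereal (s \<bullet> y)" for s
    using closed_strongly_convex_attains_inf closed_fun_tilt[OF cl] strongly_convex_fun_tilt[OF sc] pos
    by blast
  then obtain X where X: "\<And>s y. f (X s) - ereal (s \<bullet> X s) \<le> f y - ereal (s \<bullet> y)"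
    by metis
  have p: "proper_fun f"
    using sc strongly_convex_fun_iff by blast
  have "\<exists>a. f (X s) = ereal a" for s
  proof -
    obtain x0 where "f x0 \<noteq> \<infinity>" "f (X s) \<noteq> -\<infinity>"
      using p unfolding proper_fun_def by blast
    then show ?thesis
      using X[of s x0] by (cases "f (X s)"; cases "f x0") auto
  qed
  then obtain F where F: "\<And>s. f (X s) = ereal (F s)"
    by metis
  have conj: "fenchel_conjugate f s = ereal (s \<bullet> X s - F s)" for s
    unfolding fenchel_conjugate_def
  proof (rule antisym)
    show "(SUP x. ereal (s \<bullet> x) - f x) \<le> ereal (s \<bullet> X s - F s)"
    proof (rule SUP_least)
      fix x
      show "ereal (s \<bullet> x) - f x \<le> ereal (s \<bullet> X s - F s)"
        using X[of s x] F[of s] by (cases "f x") auto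
    qed
    show "ereal (s \<bullet> X s - F s) \<le> (SUP x. ereal (s \<bullet> x) - f x)"
      by (rule SUP_upper2[of "X s"]) (simp_all add: F)
  qed
  let ?g = "\<lambda>s. s \<bullet> X s - F s"
  have growth: "F s - s \<bullet> X s + \<mu> / 2 * (norm (X u - X s))\<^sup>2 \<le> F u - s \<bullet> X u" for s u
    by (rule strongly_convex_minimizer_growth[OF strongly_convex_fun_tilt[OF sc] X, of s])
      (simp_all add: F)
  have lip: "norm (X s - X u) \<le> 1 / \<mu> * norm (s - u)" for s u
  proof (cases "X s = X u")
    case False
    have "\<mu> * (norm (X s - X u))\<^sup>2 \<le> (s - u) \<bullet> (X s - X u)"
      using growth[of s u] growth[of u s]
      by (simp add: inner_diff norm_minus_commute[of "X u"] algebra_simps)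
    also have "\<dots> \<le> norm (s - u) * norm (X s - X u)"
      by (rule norm_cauchy_schwarz)
    finally have "norm (X s - X u) * (\<mu> * norm (X s - X u)) \<le> norm (X s - X u) * norm (s - u)"
      by (simp add: power2_eq_square algebra_simps)
    then have "\<mu> * norm (X s - X u) \<le> norm (s - u)"
      using False by simp
    then show ?thesis
      using pos by (simp add: field_simps)
  qed (use pos in simp)
  have sub: "?g s + (u - s) \<bullet> X s \<le> ?g u" for s u
  proof -
    have "0 \<le> \<mu> / 2 * (norm (X s - X u))\<^sup>2"
      using pos by simp
    then show ?thesis
      using growth[of u s] by (simp add: inner_diff)
  qed
  have "GDERIV ?g s :> X s" for s
    by (rule subgradient_selection_imp_gderiv[OF sub lip])
  then show ?thesis
    unfolding lipschitz_gradient_def using lip by (auto simp: conj)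
qed

section \<open>Strong convexity of the conjugate\<close>

lemma gderiv_along_line:
  fixes g :: "'a::real_inner \<Rightarrow> real"
  assumes "GDERIV g (x + t *\<^sub>R d) :> v"
  shows "((\<lambda>t. g (x + t *\<^sub>R d)) has_real_derivative v \<bullet> d) (at t)"
proof -
  have "((\<lambda>t. x + t *\<^sub>R d) has_derivative (\<lambda>h. h *\<^sub>R d)) (at t)"
    by (auto intro!: derivative_eq_intros)
  then have "((\<lambda>t. g (x + t *\<^sub>R d)) has_derivative (\<lambda>h. (h *\<^sub>R d) \<bullet> v)) (at t)"
    using has_derivative_compose assms unfolding gderiv_def by blast
  then show ?thesis
    by (simp add: has_field_derivative_def inner_commute mult_commute_abs)
qed

text \<open>
  Left-hand side minus right-hand side, taken along the segment from \<open>x\<close> to \<open>x + d\<close>, starts at \<open>0\<close> and has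
  a nonpositive derivative.
\<close>

lemma descent_lemma:
  fixes g :: "'a::real_inner \<Rightarrow> real"
  assumes G: "\<And>x. GDERIV g x :> G x" and lip: "\<And>x y. norm (G x - G y) \<le> L * norm (x - y)"
  shows "g (x + d) \<le> g x + G x \<bullet> d + L / 2 * (norm d)\<^sup>2"
proof -
  define h where "h t = g (x + t *\<^sub>R d) - t * (G x \<bullet> d) - L / 2 * (norm d)\<^sup>2 * t\<^sup>2" for t
  have deriv: "(h has_real_derivative (G (x + t *\<^sub>R d) \<bullet> d - G x \<bullet> d - L * t * (norm d)\<^sup>2)) (at t)" for t
    unfolding h_def by (rule derivative_eq_intros gderiv_along_line G refl | simp)+
  have nonpos: "G (x + t *\<^sub>R d) \<bullet> d - G x \<bullet> d - L * t * (norm d)\<^sup>2 \<le> 0" if "0 \<le> t" for t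
  proof -
    have "(G (x + t *\<^sub>R d) - G x) \<bullet> d \<le> norm (G (x + t *\<^sub>R d) - G x) * norm d"
      by (rule norm_cauchy_schwarz)
    also have "\<dots> \<le> L * norm (x + t *\<^sub>R d - x) * norm d"
      by (intro mult_right_mono lip) simp
    also have "\<dots> = L * t * (norm d)\<^sup>2"
      using that by (simp add: power2_eq_square)
    finally show ?thesis by (simp add: inner_diff_left)
  qed
  have "h 1 \<le> h 0"
  proof (rule DERIV_nonpos_imp_nonincreasing[of 0 1 h])
    fix t :: real
    assume "0 \<le> t"
    then show "\<exists>y. (h has_real_derivative y) (at t) \<and> y \<le> 0"
      using deriv[of t] nonpos[of t] by (intro exI conjI)
  qed simp
  then show ?thesis
    unfolding h_def by simp
qed

text \<open>
  Along the segment from \<open>x\<close> to \<open>y\<close>, chord minus function is nonnegative and vanishes at \<open>x\<close>, so its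
  derivative there cannot be negative.
\<close>

lemma convex_above_tangent:
  fixes g :: "'a::real_inner \<Rightarrow> real"
  assumes conv: "convex_on UNIV g" and G: "GDERIV g x :> v"
  shows "g x + v \<bullet> (y - x) \<le> g y"
proof (rule ccontr)
  assume less: "\<not> ?thesis"
  define h where "h t = (1 - t) * g x + t * g y - g (x + t *\<^sub>R (y - x))" for t
  have "((\<lambda>t. g (x + t *\<^sub>R (y - x))) has_real_derivative v \<bullet> (y - x)) (at 0)"
    by (rule gderiv_along_line) (simp add: G)
  then have "(h has_real_derivative (g y - g x - v \<bullet> (y - x))) (at 0)"
    unfolding h_def by (auto intro!: derivative_eq_intros)
  moreover have "g y - g x - v \<bullet> (y - x) < 0"
    using less by simp
  ultimately obtain e where e: "e > 0" "\<And>t. 0 < t \<Longrightarrow> t < e \<Longrightarrow> h (0 + t) < h 0"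
    using DERIV_neg_dec_right by blast
  define t where "t = min (e / 2) 1"
  have t: "0 < t" "t < e" "t \<le> 1"
    using e(1) by (auto simp: t_def)
  have "g ((1 - t) *\<^sub>R x + t *\<^sub>R y) \<le> (1 - t) * g x + t * g y"
    using convex_onD[OF conv, of t x y] t by simp
  moreover have "(1 - t) *\<^sub>R x + t *\<^sub>R y = x + t *\<^sub>R (y - x)"
    by (simp add: algebra_simps)
  ultimately have "h t \<ge> 0"
    unfolding h_def by simp
  then show False
    using e(2)[of t] t by (simp add: h_def)
qed

theorem conjugate_strongly_convex:
  fixes f :: "'a::real_inner \<Rightarrow> ereal"
  assumes conv: "convex_fun f" and lg: "lipschitz_gradient L f" and pos: "L > 0"
  shows "strongly_convex_fun (1 / L) (fenchel_conjugate f)"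
proof -
  define g where "g x = real_of_ereal (f x)" for x
  obtain G where fin: "\<And>x. \<bar>f x\<bar> \<noteq> \<infinity>" and G: "\<And>x. GDERIV g x :> G x"
    and lip: "\<And>x y. norm (G x - G y) \<le> L * norm (x - y)"
    using lg unfolding lipschitz_gradient_def g_def by blast
  have f: "f x = ereal (g x)" for x
    using fin[of x] unfolding g_def by (simp add: ereal_real)
  have "convex_on UNIV g"
    using conv convex_fun_iff_convex_on[of f] by (simp add: f)
  then have tangent: "g x + G x \<bullet> (y - x) \<le> g y" for x y
    using G by (rule convex_above_tangent)
  have below: "ereal (s \<bullet> x - g x) \<le> fenchel_conjugate f s" for s x
    unfolding fenchel_conjugate_def by (rule SUP_upper2[of x]) (simp_all add: f)
  have least: "fenchel_conjugate f s \<le> ereal c" if "\<And>x. s \<bullet> x - g x \<le> c" for s c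
    unfolding fenchel_conjugate_def by (rule SUP_least) (simp add: f that)
  have proper: "proper_fun (fenchel_conjugate f)"
  proof -
    have "fenchel_conjugate f s \<noteq> -\<infinity>" for s
      using below[of s 0] by auto
    moreover have "fenchel_conjugate f (G 0) \<le> ereal (- g 0)"
      by (rule least) (use tangent[of 0] in \<open>simp add: algebra_simps\<close>)
    then have "fenchel_conjugate f (G 0) \<noteq> \<infinity>"
      by auto
    ultimately show ?thesis
      unfolding proper_fun_def by blast
  qed
  show ?thesis
    unfolding strongly_convex_fun_iff
  proof (intro conjI proper allI impI)
    fix s u :: 'a and a b t :: real
    assume A: "0 < t \<and> t < 1 \<and> fenchel_conjugate f s = ereal a \<and> fenchel_conjugate f u = ereal b"
    let ?w = "(1 - t) *\<^sub>R s + t *\<^sub>R u"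
    let ?q = "1 / L / 2 * (t * (1 - t)) * (norm (s - u))\<^sup>2"
    show "fenchel_conjugate f ?w \<le> ereal ((1 - t) * a + t * b - ?q)"
    proof (rule least)
      fix z
      \<comment> \<open>this step maximizes \<open>(u - s) \<bullet> v - L/2 \<cdot> \<parallel>v\<parallel>\<^sup>2\<close>\<close>
      define v where "v = (1 / L) *\<^sub>R (u - s)"
      let ?n = "(norm v)\<^sup>2"
      have v: "(u - s) \<bullet> v = L * ?n" "(norm (s - u))\<^sup>2 = L\<^sup>2 * ?n"
        using pos unfolding v_def power2_norm_eq_inner
        by (simp_all add: field_simps power2_eq_square inner_diff inner_commute)
      have "s \<bullet> (z + (- t) *\<^sub>R v) - g (z + (- t) *\<^sub>R v) \<le> a"
        using below[of s "z + (- t) *\<^sub>R v"] A by simp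
      moreover have "g (z + (- t) *\<^sub>R v) \<le> g z + G z \<bullet> ((- t) *\<^sub>R v) + L / 2 * (norm ((- t) *\<^sub>R v))\<^sup>2"
        by (rule descent_lemma[OF G lip])
      ultimately have "s \<bullet> z - t * (s \<bullet> v) - g z + t * (G z \<bullet> v) - L / 2 * (t\<^sup>2 * ?n) \<le> a"
        by (simp add: inner_add inner_diff power_mult_distrib algebra_simps)
      then have 1: "(1 - t) * (s \<bullet> z - t * (s \<bullet> v) - g z + t * (G z \<bullet> v) - L / 2 * (t\<^sup>2 * ?n))
          \<le> (1 - t) * a"
        using A by (intro mult_left_mono) auto
      have "u \<bullet> (z + (1 - t) *\<^sub>R v) - g (z + (1 - t) *\<^sub>R v) \<le> b"
        using below[of u "z + (1 - t) *\<^sub>R v"] A by simp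
      moreover have "g (z + (1 - t) *\<^sub>R v) \<le> g z + G z \<bullet> ((1 - t) *\<^sub>R v) + L / 2 * (norm ((1 - t) *\<^sub>R v))\<^sup>2"
        by (rule descent_lemma[OF G lip])
      ultimately have "u \<bullet> z + (1 - t) * (u \<bullet> v) - g z - (1 - t) * (G z \<bullet> v) - L / 2 * ((1 - t)\<^sup>2 * ?n) \<le> b"
        by (simp add: inner_add inner_diff power_mult_distrib)
      then have 2: "t * (u \<bullet> z + (1 - t) * (u \<bullet> v) - g z - (1 - t) * (G z \<bullet> v) - L / 2 * ((1 - t)\<^sup>2 * ?n))
          \<le> t * b"
        using A by (intro mult_left_mono) auto
      have "(1 - t) * (s \<bullet> z - t * (s \<bullet> v) - g z + t * (G z \<bullet> v) - L / 2 * (t\<^sup>2 * ?n))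
          + t * (u \<bullet> z + (1 - t) * (u \<bullet> v) - g z - (1 - t) * (G z \<bullet> v) - L / 2 * ((1 - t)\<^sup>2 * ?n))
          = ?w \<bullet> z - g z + t * (1 - t) * ((u - s) \<bullet> v) - L / 2 * (t * (1 - t)) * ?n"
        by (simp add: inner_add inner_diff field_simps power2_eq_square)
      also have "\<dots> = ?w \<bullet> z - g z + ?q"
        unfolding v using pos by (simp add: field_simps power2_eq_square)
      finally show "?w \<bullet> z - g z \<le> (1 - t) * a + t * b - ?q"
        using 1 2 by linarith
    qed
  qed
qed

theorem theorem1:
  fixes f :: "real ^ 'n \<Rightarrow> ereal" and \<mu> L :: real
  assumes "proper_fun f" and "\<mu> > 0" and "L > 0"
  shows "(closed_fun f \<and> strongly_convex_fun \<mu> f \<longrightarrow>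
            lipschitz_gradient (1 / \<mu>) (fenchel_conjugate f)) \<and>
         (convex_fun f \<and> lipschitz_gradient L f \<longrightarrow>
            strongly_convex_fun (1 / L) (fenchel_conjugate f))"
  using conjugate_lipschitz_gradient[of f \<mu>] conjugate_strongly_convex[of f L] assms(2,3)
  by simp

end
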